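(* Let $(M_k)_{k=1}^\infty$ be a sequence of ordered matchings, where $M_k$ has size $k$, $k=1,2,\dots$. Then, asymptotically almost surely, $$\max\{k:\; M_k\preceq \mathbb{RM}_n\}\le (1+o(1))\,e\sqrt{n/2},$$ i.e., there is a sequence $\varepsilon_n\to0$ such that the probability that $\max\{k:\; M_k\preceq \mathbb{RM}_n\}\le (1+\varepsilon_n)e\sqrt{n/2}$ tends to $1$ as $n\to\infty$.
   Context: An ordered matching of size $k$ is a graph on a linearly ordered vertex set of $2k$ vertices consisting of $k$ pairwise vertex-disjoint edges. $\mathbb{RM}_n$ denotes a random ordered matching of size $n$, selected uniformly at random from all $(2n)!/(n!2^n)$ matchings of size $n$ on the vertex set $\{1,\dots,2n\}$ with its natural order. Two ordered graphs on $m$ vertices $v_1<\cdots<v_m$ and $w_1<\cdots<w_m$ are order-isomorphic if for all $i<j$, $v_iv_j$ is an edge of the first if and only if $w_iw_j$ is an edge of the second. For ordered matchings $H$ and $G$, $H\preceq G$ means that $G$ contains an ordered copy of $H$, i.e., a sub-matching (with vertices ordered as in $G$) order-isomorphic to $H$. "Asymptotically almost surely" (a.a.s.) means with probability tending to $1$ as $n\to\infty$. *)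

theory Defs
  imports "HOL-Probability.Probability"
begin

type_synonym 'a graph = "'a set \<times> 'a set set"

abbreviation verts :: "'a graph \<Rightarrow> 'a set" where "verts G \<equiv> fst G"

abbreviation edges :: "'a graph \<Rightarrow> 'a set set" where "edges G \<equiv> snd G"

definition ordered_matching :: "nat \<Rightarrow> ('a::linorder) graph \<Rightarrow> bool" where
  "ordered_matching k G \<longleftrightarrow>
     finite (verts G) \<and> card (verts G) = 2 * k \<and>
     finite (edges G) \<and> card (edges G) = k \<and>
     (\<forall>e\<in>edges G. e \<subseteq> verts G \<and> card e = 2) \<and>
     pairwise disjnt (edges G)"

definition order_isomorphic :: "('a::linorder) graph \<Rightarrow> ('b::linorder) graph \<Rightarrow> bool" where
  "order_isomorphic G H \<longleftrightarrow>
     finite (verts G) \<and> finite (verts H) \<and> card (verts G) = card (verts H) \<and>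
     (let v = sorted_list_of_set (verts G); w = sorted_list_of_set (verts H)
      in \<forall>i j. i < j \<and> j < card (verts G) \<longrightarrow>
           ({v ! i, v ! j} \<in> edges G \<longleftrightarrow> {w ! i, w ! j} \<in> edges H))"

definition submatching :: "('a::linorder) graph \<Rightarrow> 'a graph \<Rightarrow> bool" where
  "submatching H G \<longleftrightarrow>
     (\<exists>k. ordered_matching k H) \<and> verts H \<subseteq> verts G \<and> edges H \<subseteq> edges G"

definition contains_copy :: "('a::linorder) graph \<Rightarrow> ('b::linorder) graph \<Rightarrow> bool"
    (infix "\<preceq>\<^sub>m" 50) where
  "H \<preceq>\<^sub>m G \<longleftrightarrow> (\<exists>H'. submatching H' G \<and> order_isomorphic H H')"

definition matchings_on :: "nat \<Rightarrow> nat graph set" where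
  "matchings_on n = {G. verts G = {1..2*n} \<and> ordered_matching n G}"

lemma finite_matchings_on: "finite (matchings_on n)"
proof -
  have "matchings_on n \<subseteq> Pow {1..2*n} \<times> Pow (Pow {1..2*n})"
    unfolding matchings_on_def ordered_matching_def by fastforce
  thus ?thesis by (rule finite_subset) auto
qed

lemma matchings_on_nonempty: "matchings_on n \<noteq> {}"
proof -
  let ?E = "(\<lambda>i. {2*i+1, 2*i+2}) ` {..<n}"
  have "inj_on (\<lambda>i::nat. {2*i+1, 2*i+2}) {..<n}" by (auto simp: inj_on_def doubleton_eq_iff)
  hence c: "card ?E = n" by (simp add: card_image)
  have p: "pairwise disjnt ?E" unfolding pairwise_def disjnt_def by auto presburger+
  have "({1..2*n}, ?E) \<in> matchings_on n" using c p by (auto simp: matchings_on_def ordered_matching_def)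
  thus ?thesis by blast
qed

definition RM :: "nat \<Rightarrow> nat graph pmf" where
  "RM n = pmf_of_set (matchings_on n)"

text \<open>
  The set below is contained in \<open>{1..n}\<close> when \<open>G\<close> has size \<open>n\<close> and each \<open>M k\<close> has size \<open>k\<close>,
  and it contains \<open>1\<close> as soon as \<open>n \<ge> 1\<close>; only for \<open>n = 0\<close> is it empty
  (and \<open>Max\<close> unspecified).
\<close>

definition max_copy :: "(nat \<Rightarrow> ('a::linorder) graph) \<Rightarrow> ('b::linorder) graph \<Rightarrow> nat" where
  "max_copy M G = Max {k. 1 \<le> k \<and> M k \<preceq>\<^sub>m G}"

end

theory Submission
  imports Defs "HOL-Real_Asymp.Real_Asymp"
begin

text \<open>
  First moment method. A copy of \<open>M k\<close> in a matching on \<open>2n\<close> vertices is determined by its vertex set,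
  and a given matching of size \<open>k\<close> extends to \<open>(2(n-k))! / (2^(n-k) (n-k)!)\<close> perfect matchings, so
  the expected number of copies is at most
  \<open>2^k n! / ((n-k)! (2k)!) \<le> (2n)^k / (2k)! \<le> (e \<surd>(n/2) / k)^(2k)\<close>.
  For \<open>k > (1 + \<epsilon>) e \<surd>(n/2)\<close> this is below \<open>(1 + \<epsilon>)^(-2k)\<close>. Containing \<open>M k\<close> is not monotone in \<open>k\<close>,
  so one sums over all such \<open>k \<le> n\<close>; \<open>\<epsilon> = n^(-1/4)\<close> makes the sum vanish.
\<close>

section \<open>Counting perfect matchings of a finite set\<close>

text \<open>Only the edge set is recorded, and covering \<open>A\<close> replaces prescribing the
  number of edges. In this form, removing some edges together with their vertices leaves an object
  of the same kind.\<close>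

definition perfect_matchings :: "'a set \<Rightarrow> 'a set set set" where
  "perfect_matchings A = {E. (\<forall>e\<in>E. card e = 2) \<and> pairwise disjnt E \<and> \<Union>E = A}"

lemma perfect_matchings_subset: "perfect_matchings A \<subseteq> Pow (Pow A)"
  by (auto simp: perfect_matchings_def)

lemma finite_perfect_matchings: "finite A \<Longrightarrow> finite (perfect_matchings A)"
  using perfect_matchings_subset by (rule finite_subset) auto

lemma card_Union_pairs:
  assumes "\<forall>e\<in>E. card e = 2" "pairwise disjnt E"
  shows "card (\<Union>E) = 2 * card E"
proof -
  have "card (\<Union>E) = sum card E"
    using assms by (intro card_Union_disjoint) (auto intro: card_ge_0_finite)
  also have "\<dots> = 2 * card E" using assms by simp
  finally show ?thesis .
qed

text \<open>By counting: \<open>k\<close> disjoint pairs cover \<open>2 * k\<close> points, hence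
  all of a vertex set of that size.\<close>

lemma ordered_matching_iff:
  "ordered_matching k G \<longleftrightarrow>
     finite (verts G) \<and> card (verts G) = 2 * k \<and> edges G \<in> perfect_matchings (verts G)"
proof
  assume G: "ordered_matching k G"
  hence "card (\<Union>(edges G)) = card (verts G)"
    by (subst card_Union_pairs) (auto simp: ordered_matching_def)
  moreover have "\<Union>(edges G) \<subseteq> verts G" "finite (verts G)"
    using G by (auto simp: ordered_matching_def)
  ultimately have "\<Union>(edges G) = verts G" by (simp add: card_subset_eq)
  thus "finite (verts G) \<and> card (verts G) = 2 * k \<and> edges G \<in> perfect_matchings (verts G)"
    using G by (auto simp: ordered_matching_def perfect_matchings_def)
next
  assume G: "finite (verts G) \<and> card (verts G) = 2 * k \<and> edges G \<in> perfect_matchings (verts G)"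
  hence E: "\<forall>e\<in>edges G. card e = 2" "pairwise disjnt (edges G)" "\<Union>(edges G) = verts G"
    by (auto simp: perfect_matchings_def)
  have "finite (edges G)" using E(3) G by (metis finite_UnionD)
  moreover have "card (edges G) = k" using card_Union_pairs[OF E(1,2)] E(3) G by simp
  ultimately show "ordered_matching k G"
    using G E by (auto simp: ordered_matching_def)
qed

text \<open>An edge of \<open>E\<close> outside \<open>F\<close> is disjoint from every edge of
  \<open>F\<close>, so it avoids \<open>B\<close>; deleting and adding \<open>F\<close> are
  therefore mutually inverse. This serves twice: with a single edge in the recursion for the number
  of perfect matchings, and with a whole copy of \<open>M k\<close> when its extensions are
  counted.\<close>

lemma bij_betw_perfect_matchings_superset:
  assumes F: "F \<in> perfect_matchings B" and "B \<subseteq> A"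
  shows "bij_betw (\<lambda>E. E - F) {E \<in> perfect_matchings A. F \<subseteq> E} (perfect_matchings (A - B))"
proof (rule bij_betwI[where g = "\<lambda>E. E \<union> F"])
  have UF: "\<Union>F = B" using F by (simp add: perfect_matchings_def)
  show "(\<lambda>E. E - F) \<in> {E \<in> perfect_matchings A. F \<subseteq> E} \<rightarrow> perfect_matchings (A - B)"
  proof
    fix E assume "E \<in> {E \<in> perfect_matchings A. F \<subseteq> E}"
    hence E: "\<forall>e\<in>E. card e = 2" "pairwise disjnt E" "\<Union>E = A" "F \<subseteq> E"
      by (auto simp: perfect_matchings_def)
    have "\<Union>(E - F) = A - B"
    proof -
      have "e \<inter> f = {}" if "e \<in> E - F" "f \<in> F" for e f
        using pairwiseD[OF E(2), of e f] that E(4) by (auto simp: disjnt_def)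
      hence "e \<inter> B = {}" if "e \<in> E - F" for e
        using that UF by blast
      thus ?thesis using E(3) UF by blast
    qed
    thus "E - F \<in> perfect_matchings (A - B)"
      using E by (auto simp: perfect_matchings_def intro: pairwise_mono)
  qed
  \<comment> \<open>A common edge would lie inside both \<open>A - B\<close> and \<open>B\<close>,
    hence be empty, while edges have two elements.\<close>
  have disj: "E \<inter> F = {}" if "E \<in> perfect_matchings (A - B)" for E
  proof -
    have "e = {}" if "e \<in> E" "e \<in> F" for e
      using that \<open>E \<in> _\<close> UF by (auto simp: perfect_matchings_def)
    moreover have "{} \<notin> F" using F by (auto simp: perfect_matchings_def)
    ultimately show ?thesis by blast
  qed
  show "(\<lambda>E. E \<union> F) \<in> perfect_matchings (A - B) \<rightarrow> {E \<in> perfect_matchings A. F \<subseteq> E}"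
  proof
    fix E assume "E \<in> perfect_matchings (A - B)"
    hence E: "\<forall>e\<in>E. card e = 2" "pairwise disjnt E" "\<Union>E = A - B"
      by (auto simp: perfect_matchings_def)
    have cross: "disjnt e f" if "e \<in> E" "f \<in> F" for e f
      using that E(3) UF by (auto simp: disjnt_def)
    have "pairwise disjnt (E \<union> F)"
      using E(2) F cross
      by (auto simp: pairwise_def perfect_matchings_def disjnt_sym)
    moreover have "\<Union>(E \<union> F) = A" using E(3) UF \<open>B \<subseteq> A\<close> by auto
    ultimately show "E \<union> F \<in> {E \<in> perfect_matchings A. F \<subseteq> E}"
      using E(1) F by (auto simp: perfect_matchings_def)
  qed
  show "E - F \<union> F = E" if "E \<in> {E \<in> perfect_matchings A. F \<subseteq> E}" for E
    using that by auto
  show "E \<union> F - F = E" if "E \<in> perfect_matchings (A - B)" for E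
    using disj[OF that] by auto
qed

text \<open>Fix a vertex \<open>a\<close> and classify the matchings by its partner
  \<open>b\<close>: each of the \<open>2 * m + 1\<close> partners leaves a perfect matching of the
  remaining \<open>2 * m\<close> vertices. The formula is kept in product form to avoid division on
  naturals.\<close>

lemma card_perfect_matchings:
  assumes "finite A" "card A = 2 * m"
  shows "card (perfect_matchings A) * (2 ^ m * fact m) = fact (2 * m)"
  using assms
proof (induction m arbitrary: A)
  case 0
  hence "A = {}" by simp
  hence "perfect_matchings A = {{}}" by (fastforce simp: perfect_matchings_def)
  thus ?case by simp
next
  case (Suc m)
  then obtain a where a: "a \<in> A" by (metis all_not_in_conv card.empty mult_Suc_right nat.distinct(1) add_2_eq_Suc)
  let ?S = "\<lambda>b. {E \<in> perfect_matchings A. {{a, b}} \<subseteq> E}"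
  have edge: "\<exists>b\<in>A - {a}. {a, b} \<in> E" if "E \<in> perfect_matchings A" for E
  proof -
    have E: "\<forall>e\<in>E. card e = 2" "\<Union>E = A"
      using that by (auto simp: perfect_matchings_def)
    obtain e where e: "e \<in> E" "a \<in> e" using a E(2) by blast
    have "card e = 2" "e \<subseteq> A" using E e by auto
    then obtain b where "e = {a, b}" "b \<noteq> a"
      using \<open>a \<in> e\<close> by (auto simp: card_2_iff)
    thus ?thesis using e \<open>e \<subseteq> A\<close> by auto
  qed
  have un: "perfect_matchings A = (\<Union>b\<in>A - {a}. ?S b)"
    using edge by auto
  have disj: "?S b \<inter> ?S c = {}" if "b \<in> A - {a}" "c \<in> A - {a}" "b \<noteq> c" for b c
  proof -
    have "{a, b} \<noteq> {a, c}" "\<not> disjnt {a, b} {a, c}" using that by (auto simp: doubleton_eq_iff)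
    hence "\<not> pairwise disjnt E" if "{a, b} \<in> E" "{a, c} \<in> E" for E
      using that by (auto dest: pairwiseD)
    thus ?thesis by (auto simp: perfect_matchings_def)
  qed
  have part: "card (?S b) * (2 ^ m * fact m) = fact (2 * m)" if "b \<in> A - {a}" for b
  proof -
    have "{{a, b}} \<in> perfect_matchings {a, b}"
      using that by (auto simp: perfect_matchings_def)
    hence "card (?S b) = card (perfect_matchings (A - {a, b}))"
      using bij_betw_same_card[OF bij_betw_perfect_matchings_superset[of "{{a,b}}" "{a,b}" A]] a that
      by simp
    moreover have "card (A - {a, b}) = 2 * m"
      using Suc.prems a that by (subst card_Diff_subset) auto
    ultimately show ?thesis using Suc.IH[of "A - {a, b}"] Suc.prems by simp
  qed
  have "card (\<Union>b\<in>A - {a}. ?S b) = (\<Sum>b\<in>A - {a}. card (?S b))"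
  proof (rule card_UN_disjoint)
    show "\<forall>b\<in>A - {a}. \<forall>c\<in>A - {a}. b \<noteq> c \<longrightarrow> ?S b \<inter> ?S c = {}"
      using disj by (intro ballI impI)
  qed (use Suc.prems in \<open>simp_all add: finite_perfect_matchings\<close>)
  hence "card (perfect_matchings A) = (\<Sum>b\<in>A - {a}. card (?S b))"
    by (simp only: un[symmetric])
  hence "card (perfect_matchings A) * (2 ^ m * fact m) = (\<Sum>b\<in>A - {a}. fact (2 * m))"
    using part by (simp add: sum_distrib_right)
  also have "\<dots> = (2 * m + 1) * fact (2 * m)"
    using Suc.prems a by simp
  finally have IH: "card (perfect_matchings A) * (2 ^ m * fact m) = (2 * m + 1) * fact (2 * m)" .
  \<comment> \<open>The factor \<open>2 * m + 2 = 2 * Suc m\<close> supplies both the extra power of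
    2 and the extra factor of \<open>fact (Suc m)\<close>; on the other side it completes
    \<open>fact (2 * m + 2)\<close>.\<close>
  have "card (perfect_matchings A) * (2 ^ Suc m * fact (Suc m))
      = (2 * m + 2) * (card (perfect_matchings A) * (2 ^ m * fact m))"
    by (simp add: algebra_simps)
  also have "\<dots> = fact (2 * Suc m)"
    unfolding IH by (simp add: algebra_simps)
  finally show ?case .
qed

lemma matchings_on_eq: "matchings_on n = Pair {1..2*n} ` perfect_matchings {1..2*n}"
  by (force simp: matchings_on_def ordered_matching_iff image_iff)

section \<open>Ordered copies: uniqueness on a vertex set, and size\<close>

text \<open>Both copies have the same sorted vertex list, so an edge of \<open>H1\<close> is pulled
  back to \<open>H\<close> by its positions and pushed forward to the same pair in
  \<open>H2\<close>. Isomorphism speaks only of positions \<open>i < j\<close>; the matching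
  hypothesis ensures that every edge of \<open>H1\<close> is such a pair.\<close>

lemma order_isomorphic_edges_subset:
  assumes "order_isomorphic H H1" "order_isomorphic H H2" "verts H1 = verts H2"
    and "edges H1 \<in> perfect_matchings (verts H1)"
  shows "edges H1 \<subseteq> edges H2"
proof
  fix e assume e: "e \<in> edges H1"
  define w where "w = sorted_list_of_set (verts H1)"
  have fin: "finite (verts H1)" and card: "card (verts H) = card (verts H1)"
    using assms(1) by (auto simp: order_isomorphic_def)
  have w: "set w = verts H1" "length w = card (verts H1)"
    using fin by (auto simp: w_def)
  from e assms(4) have "card e = 2" "e \<subseteq> set w"
    by (auto simp: perfect_matchings_def w(1))
  then obtain x y where "e = {x, y}" "x \<noteq> y" "x \<in> set w" "y \<in> set w"
    by (auto simp: card_2_iff)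
  then obtain i j where "e = {w ! i, w ! j}" "i < length w" "j < length w" "i \<noteq> j"
    by (metis in_set_conv_nth)
  then obtain i j where ij: "e = {w ! i, w ! j}" "i < j" "j < card (verts H)"
    by (metis insert_commute linorder_neqE_nat w(2) card)
  let ?v = "sorted_list_of_set (verts H)"
  have "{?v ! i, ?v ! j} \<in> edges H"
    using assms(1) ij e by (auto simp: order_isomorphic_def Let_def w_def)
  thus "e \<in> edges H2"
    using assms(2) ij by (auto simp: order_isomorphic_def Let_def w_def assms(3))
qed

text \<open>This is what lets copies be counted by their vertex sets alone.\<close>

lemma order_isomorphic_edges_unique:
  assumes "order_isomorphic H H1" "order_isomorphic H H2" "verts H1 = verts H2"
    and "edges H1 \<in> perfect_matchings (verts H1)" "edges H2 \<in> perfect_matchings (verts H2)"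
  shows "edges H1 = edges H2"
  using order_isomorphic_edges_subset[OF assms(1-4)]
    order_isomorphic_edges_subset[OF assms(2,1) assms(3)[symmetric] assms(5)] by simp

lemma contains_copy_size_le:
  assumes "ordered_matching k H" "ordered_matching n G" "H \<preceq>\<^sub>m G"
  shows "k \<le> n"
proof -
  obtain H' where H': "verts H' \<subseteq> verts G" "card (verts H) = card (verts H')"
    using assms(3) by (auto simp: contains_copy_def submatching_def order_isomorphic_def)
  have "card (verts H') \<le> card (verts G)"
    using H' assms(2) by (intro card_mono) (auto simp: ordered_matching_def)
  thus ?thesis using H' assms by (simp add: ordered_matching_def)
qed

text \<open>Any edge of \<open>G\<close> serves as the copy, since a single edge on two vertices has
  only one order type. It keeps the set inside \<open>Max\<close> nonempty.\<close>

lemma contains_copy_size_one: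
  fixes H :: "('a::linorder) graph" and G :: "('b::linorder) graph"
  assumes "ordered_matching 1 H" "ordered_matching n G" "n \<ge> 1"
  shows "H \<preceq>\<^sub>m G"
proof -
  have "edges G \<noteq> {}" using assms by (auto simp: ordered_matching_def)
  then obtain e where e: "e \<in> edges G" "card e = 2" "e \<subseteq> verts G"
    using assms(2) by (auto simp: ordered_matching_def)
  have fe: "finite e" using e(2) by (simp add: card_ge_0_finite)
  have pair: "{sorted_list_of_set A ! 0, sorted_list_of_set A ! 1} = A"
    if "finite A" "card A = 2" for A :: "('c::linorder) set"
  proof -
    let ?v = "sorted_list_of_set A"
    have "length ?v = 2" using that by simp
    then obtain x y where "?v = [x, y]"
      by (metis (no_types) One_nat_def Suc_length_conv length_0_conv numeral_2_eq_2)
    moreover have "set ?v = A" using that by simp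
    ultimately show ?thesis by auto
  qed
  have H: "finite (verts H)" "card (verts H) = 2" "edges H = {verts H}"
  proof -
    show f: "finite (verts H)" "card (verts H) = 2" using assms(1) by (auto simp: ordered_matching_def)
    obtain h where h: "edges H = {h}" using assms(1)
      by (auto simp: ordered_matching_def card_1_singleton_iff)
    hence "h = verts H" using assms(1)
      by (auto simp: ordered_matching_iff perfect_matchings_def)
    thus "edges H = {verts H}" using h by simp
  qed
  have "order_isomorphic H (e, {e})"
    unfolding order_isomorphic_def Let_def
  proof (intro conjI allI impI)
    fix i j :: nat assume "i < j \<and> j < card (verts H)"
    hence "i = 0" "j = 1" using H(2) by auto
    thus "({sorted_list_of_set (verts H) ! i, sorted_list_of_set (verts H) ! j} \<in> edges H) =
       ({sorted_list_of_set (verts (e, {e})) ! i, sorted_list_of_set (verts (e, {e})) ! j}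
         \<in> edges (e, {e}))"
      using pair[OF H(1,2)] pair[OF fe e(2)] H(3) by simp
  qed (use H e fe in auto)
  moreover have "ordered_matching 1 (e, {e})"
    using e fe by (auto simp: ordered_matching_def)
  hence "submatching (e, {e}) G" using e by (auto simp: submatching_def)
  ultimately show ?thesis by (auto simp: contains_copy_def)
qed

section \<open>First moment bound for one fixed pattern\<close>

text \<open>Union bound over the \<open>2 * k\<close>-subsets \<open>V\<close> that may carry the
  copy: on each, the edges of the copy are forced, and the rest is a perfect matching of the
  \<open>2 * (n - k)\<close> other vertices.\<close>

lemma card_matchings_containing_copy_le:
  assumes H: "ordered_matching k H" and "k \<le> n"
  shows "card {G \<in> matchings_on n. H \<preceq>\<^sub>m G} * (2 ^ (n - k) * fact (n - k))
         \<le> ((2 * n) choose (2 * k)) * fact (2 * (n - k))"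
proof -
  let ?A = "{1..2*n}"
  let ?\<V> = "{V. V \<subseteq> ?A \<and> card V = 2 * k}"
  define T where "T V = {E \<in> perfect_matchings ?A. \<exists>F \<in> perfect_matchings V. order_isomorphic H (V, F) \<and> F \<subseteq> E}" for V
  have fin: "finite (T V)" for V by (simp add: T_def finite_perfect_matchings)
  have cardT: "card (T V) * (2 ^ (n - k) * fact (n - k)) \<le> fact (2 * (n - k))" if V: "V \<in> ?\<V>" for V
  \<comment> \<open>The case split avoids constructing a copy on \<open>V\<close>: an element of
    \<open>T V\<close> provides one, and by uniqueness every other element contains the same
    \<open>F\<close>.\<close>
  proof (cases "T V = {}")
    case False
    then obtain F where F: "F \<in> perfect_matchings V" "order_isomorphic H (V, F)"
      by (auto simp: T_def)
    have "T V \<subseteq> {E \<in> perfect_matchings ?A. F \<subseteq> E}"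
      using order_isomorphic_edges_unique[OF F(2)] F(1) by (fastforce simp: T_def)
    hence "card (T V) \<le> card {E \<in> perfect_matchings ?A. F \<subseteq> E}"
      by (intro card_mono) (auto simp: finite_perfect_matchings)
    also have "\<dots> = card (perfect_matchings (?A - V))"
      using V F by (intro bij_betw_same_card[OF bij_betw_perfect_matchings_superset]) auto
    finally have "card (T V) * (2 ^ (n - k) * fact (n - k)) \<le> card (perfect_matchings (?A - V)) * (2 ^ (n - k) * fact (n - k))"
      by (rule mult_right_mono) simp
    also have "\<dots> = fact (2 * (n - k))"
    proof (rule card_perfect_matchings)
      have "finite V" using V by (auto intro: finite_subset)
      thus "card (?A - V) = 2 * (n - k)" using V by (subst card_Diff_subset) auto
    qed simp
    finally show ?thesis .
  qed simp
  have "{G \<in> matchings_on n. H \<preceq>\<^sub>m G} \<subseteq> Pair ?A ` (\<Union>V\<in>?\<V>. T V)"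
  proof
    fix G assume "G \<in> {G \<in> matchings_on n. H \<preceq>\<^sub>m G}"
    then obtain E H' where G: "G = (?A, E)" "E \<in> perfect_matchings ?A"
      and H': "submatching H' G" "order_isomorphic H H'"
      by (auto simp: matchings_on_eq contains_copy_def)
    have "card (verts H') = 2 * k"
      using H H'(2) by (simp add: order_isomorphic_def ordered_matching_def)
    hence "verts H' \<in> ?\<V>" using H'(1) G(1) by (simp add: submatching_def)
    moreover have "E \<in> T (verts H')"
      using H' G by (auto simp: T_def submatching_def ordered_matching_iff intro!: bexI[of _ "edges H'"])
    ultimately show "G \<in> Pair ?A ` (\<Union>V\<in>?\<V>. T V)" using G(1) by blast
  qed
  hence "card {G \<in> matchings_on n. H \<preceq>\<^sub>m G} \<le> card (Pair ?A ` (\<Union>V\<in>?\<V>. T V))"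
    by (intro card_mono) (auto simp: fin)
  also have "\<dots> = card (\<Union>V\<in>?\<V>. T V)" by (intro card_image) (simp add: inj_on_def)
  also have "\<dots> \<le> (\<Sum>V\<in>?\<V>. card (T V))" by (intro card_UN_le) auto
  finally have "card {G \<in> matchings_on n. H \<preceq>\<^sub>m G} * (2 ^ (n - k) * fact (n - k))
      \<le> (\<Sum>V\<in>?\<V>. card (T V)) * (2 ^ (n - k) * fact (n - k))"
    by (rule mult_right_mono) simp
  also have "\<dots> = (\<Sum>V\<in>?\<V>. card (T V) * (2 ^ (n - k) * fact (n - k)))"
    by (rule sum_distrib_right)
  also have "\<dots> \<le> (\<Sum>V\<in>?\<V>. fact (2 * (n - k)))" by (intro sum_mono cardT)
  also have "\<dots> = ((2 * n) choose (2 * k)) * fact (2 * (n - k))"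
    by (simp add: n_subsets)
  finally show ?thesis .
qed

lemma prob_RM: "measure_pmf.prob (RM n) S = card (matchings_on n \<inter> S) / card (matchings_on n)"
  by (simp add: RM_def measure_pmf_of_set finite_matchings_on matchings_on_nonempty)

text \<open>Dividing the previous count by the number of matchings gives
  \<open>2 ^ k * fact n / (fact (n - k) * fact (2 * k))\<close>, and the quotient of factorials of
  \<open>n\<close> and \<open>n - k\<close> has \<open>k\<close> factors, each at most
  \<open>n\<close>. For \<open>k > n\<close> there is no copy.\<close>

lemma prob_contains_copy_le:
  assumes H: "ordered_matching k H"
  shows "measure_pmf.prob (RM n) {G. H \<preceq>\<^sub>m G} \<le> (2 * real n) ^ k / fact (2 * k)"
proof (cases "k \<le> n")
  case True
  let ?c = "real (card {G \<in> matchings_on n. H \<preceq>\<^sub>m G})"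
  let ?N = "real (card (matchings_on n))"
  have "card (matchings_on n) = card (perfect_matchings {1..2*n})"
    unfolding matchings_on_eq by (intro card_image) (simp add: inj_on_def)
  hence "card (matchings_on n) * (2 ^ n * fact n) = fact (2 * n)"
    using card_perfect_matchings[of "{1..2*n}" n] by simp
  from arg_cong[OF this, of real] have N: "?N = fact (2 * n) / (2 ^ n * fact n)"
    by (simp add: field_simps)
  have "real (card {G \<in> matchings_on n. H \<preceq>\<^sub>m G} * (2 ^ (n - k) * fact (n - k)))
         \<le> real (((2 * n) choose (2 * k)) * fact (2 * (n - k)))"
    using card_matchings_containing_copy_le[OF H True] by (rule of_nat_mono)
  also have "real (((2 * n) choose (2 * k)) * fact (2 * (n - k))) = fact (2 * n) / fact (2 * k)"
    using True binomial_fact[of "2 * k" "2 * n", where ?'a = real]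
    by (simp add: field_simps diff_mult_distrib)
  finally have c: "?c \<le> fact (2 * n) / fact (2 * k) / (2 ^ (n - k) * fact (n - k))"
    by (simp add: field_simps)
  have "measure_pmf.prob (RM n) {G. H \<preceq>\<^sub>m G} = ?c / ?N"
    by (simp add: prob_RM Int_def)
  also have "\<dots> \<le> fact (2 * n) / fact (2 * k) / (2 ^ (n - k) * fact (n - k)) / ?N"
    using c by (rule divide_right_mono) simp
  also have "\<dots> = 2 ^ k * (fact n / fact (n - k)) / fact (2 * k)"
    using True unfolding N by (simp add: field_simps flip: power_add)
  also have "\<dots> \<le> 2 ^ k * real n ^ k / fact (2 * k)"
  proof -
    \<comment> \<open>The known bound concerns natural division; divisibility of the factorials
      makes that division exact before passing to the reals.\<close>
    have "fact n \<le> n ^ k * (fact (n - k) :: nat)"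
      using fact_div_fact_le_pow[OF True]
      by (metis diff_le_self dvd_div_mult_self fact_dvd mult_le_mono1)
    from of_nat_mono[OF this] have "fact n / fact (n - k) \<le> real n ^ k"
      by (simp add: field_simps)
    thus ?thesis by (intro divide_right_mono mult_left_mono) auto
  qed
  finally show ?thesis by (simp add: power_mult_distrib)
next
  case False
  hence "matchings_on n \<inter> {G. H \<preceq>\<^sub>m G} = {}"
    using contains_copy_size_le[OF H] by (auto simp: matchings_on_def)
  thus ?thesis by (simp add: prob_RM)
qed

text \<open>\<open>m ^ m / fact m\<close> is a single term of the series of \<open>exp m\<close>.
  For \<open>m = 0\<close> both sides are 1, because the zeroth power of anything is 1.\<close>

lemma inverse_fact_le: "1 / fact m \<le> (exp 1 / real m) ^ m"
proof (cases "m = 0")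
  case False
  have "real m ^ m / fact m = (\<Sum>i\<in>{m}. real m ^ i /\<^sub>R fact i)"
    by (simp add: divide_inverse mult.commute)
  also have "\<dots> \<le> (\<Sum>i. real m ^ i /\<^sub>R fact i)"
    by (rule sum_le_suminf[OF summable_exp_generic]) auto
  also have "\<dots> = exp (real m)" by (simp add: exp_def)
  also have "\<dots> = exp 1 ^ m" by (simp flip: exp_of_nat_mult)
  finally show ?thesis using False by (simp add: field_simps)
qed simp

text \<open>The bound does not depend on \<open>k\<close>, so it can be summed over all large
  \<open>k\<close> at the cost of a factor counting them.\<close>

lemma prob_contains_copy_le_powr:
  assumes H: "ordered_matching k H" and "\<epsilon> > 0" "n \<ge> 1"
    and k: "real k > (1 + \<epsilon>) * exp 1 * sqrt (real n / 2)"
  shows "measure_pmf.prob (RM n) {G. H \<preceq>\<^sub>m G} \<le> (1 + \<epsilon>) powr (- 2 * exp 1 * sqrt (real n / 2))"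
proof -
  let ?s = "exp 1 * sqrt (real n / 2)"
  have s: "?s > 0" using \<open>n \<ge> 1\<close> by simp
  have "?s \<le> (1 + \<epsilon>) * ?s" using s \<open>\<epsilon> > 0\<close> by (simp add: algebra_simps)
  hence sk: "?s < real k" using k unfolding mult.assoc by linarith
  have k0: "real k > 0" using s sk by linarith
  have "measure_pmf.prob (RM n) {G. H \<preceq>\<^sub>m G} \<le> (2 * real n) ^ k * (1 / fact (2 * k))"
    using prob_contains_copy_le[OF H, of n] by simp
  also have "\<dots> \<le> (2 * real n) ^ k * (exp 1 / real (2 * k)) ^ (2 * k)"
    by (intro mult_left_mono inverse_fact_le) auto
  also have "\<dots> = (?s / real k) ^ (2 * k)"
  proof -
    \<comment> \<open>The threshold \<open>exp 1 * sqrt (n / 2)\<close> originates here: its square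
      is \<open>2 * n * (exp 1 / 2)^2\<close>.\<close>
    have "2 * real n * (exp 1 / real (2 * k))\<^sup>2 = (?s / real k)\<^sup>2"
      by (simp add: power_mult_distrib power_divide)
    thus ?thesis by (metis power_mult power_mult_distrib)
  qed
  also have "\<dots> \<le> (1 / (1 + \<epsilon>)) ^ (2 * k)"
    using k k0 s \<open>\<epsilon> > 0\<close> by (intro power_mono) (auto simp: field_simps)
  also have "\<dots> = (1 + \<epsilon>) powr (- real (2 * k))"
    using \<open>\<epsilon> > 0\<close> by (simp add: powr_minus powr_realpow power_divide divide_inverse
        power_inverse del: of_nat_mult)
  \<comment> \<open>Since \<open>k\<close> exceeds \<open>?s\<close>, the exponent may be weakened
    from \<open>- 2 * k\<close> to \<open>- 2 * ?s\<close>.\<close>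
  also have "\<dots> \<le> (1 + \<epsilon>) powr (- 2 * exp 1 * sqrt (real n / 2))"
    using sk \<open>\<epsilon> > 0\<close> by (intro powr_mono) auto
  finally show ?thesis .
qed

section \<open>From single patterns to the maximum\<close>

lemma max_copy_attained:
  assumes M: "\<And>k. k \<ge> 1 \<Longrightarrow> ordered_matching k (M k)" and G: "ordered_matching n G" and "n \<ge> 1"
  shows "max_copy M G \<in> {1..n}" "M (max_copy M G) \<preceq>\<^sub>m G"
proof -
  let ?K = "{k. 1 \<le> k \<and> M k \<preceq>\<^sub>m G}"
  have sub: "?K \<subseteq> {1..n}" using contains_copy_size_le[OF M G] by auto
  have "1 \<in> ?K" using contains_copy_size_one[OF M G \<open>n \<ge> 1\<close>] by simp
  hence "Max ?K \<in> ?K" using sub by (intro Max_in) (auto intro: finite_subset)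
  thus "max_copy M G \<in> {1..n}" "M (max_copy M G) \<preceq>\<^sub>m G"
    using sub by (auto simp: max_copy_def)
qed

text \<open>The maximum is attained, so a large maximum means that some \<open>M k\<close> with
  \<open>k\<close> above the threshold and at most \<open>n\<close> is contained; a union bound over
  these \<open>k\<close> follows.\<close>

lemma prob_max_copy_gt_le:
  assumes M: "\<And>k. k \<ge> 1 \<Longrightarrow> ordered_matching k (M k)" and "\<epsilon> > 0" "n \<ge> 1"
  shows "measure_pmf.prob (RM n) {G. real (max_copy M G) > (1 + \<epsilon>) * exp 1 * sqrt (real n / 2)}
         \<le> real n * (1 + \<epsilon>) powr (- 2 * exp 1 * sqrt (real n / 2))"
proof -
  let ?L = "(1 + \<epsilon>) * exp 1 * sqrt (real n / 2)"
  let ?q = "(1 + \<epsilon>) powr (- 2 * exp 1 * sqrt (real n / 2))"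
  let ?K = "{k \<in> {1..n}. real k > ?L}"
  \<comment> \<open>Outside the support \<open>G\<close> need not be a matching of size
    \<open>n\<close>, and the maximum is then uncontrolled.\<close>
  have sub: "{G. real (max_copy M G) > ?L} \<inter> set_pmf (RM n) \<subseteq> (\<Union>k\<in>?K. {G. M k \<preceq>\<^sub>m G})"
  proof
    fix G assume G: "G \<in> {G. real (max_copy M G) > ?L} \<inter> set_pmf (RM n)"
    hence "G \<in> matchings_on n"
      by (simp add: RM_def finite_matchings_on matchings_on_nonempty)
    hence "ordered_matching n G" by (simp add: matchings_on_def)
    from max_copy_attained[OF M this \<open>n \<ge> 1\<close>] G
    show "G \<in> (\<Union>k\<in>?K. {G. M k \<preceq>\<^sub>m G})" by blast
  qed
  have "measure_pmf.prob (RM n) {G. real (max_copy M G) > ?L}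
      = measure_pmf.prob (RM n) ({G. real (max_copy M G) > ?L} \<inter> set_pmf (RM n))"
    by (simp add: measure_Int_set_pmf)
  also have "\<dots> \<le> measure_pmf.prob (RM n) (\<Union>k\<in>?K. {G. M k \<preceq>\<^sub>m G})"
    using sub by (intro measure_pmf.finite_measure_mono) auto
  also have "\<dots> \<le> (\<Sum>k\<in>?K. measure_pmf.prob (RM n) {G. M k \<preceq>\<^sub>m G})"
    by (intro measure_pmf.finite_measure_subadditive_finite) auto
  also have "\<dots> \<le> (\<Sum>k\<in>?K. ?q)"
    using assms by (intro sum_mono prob_contains_copy_le_powr) auto
  also have "\<dots> = real (card ?K) * ?q" by simp
  also have "\<dots> \<le> real n * ?q"
  proof -
    have "card ?K \<le> card {1..n}" by (intro card_mono) auto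
    thus ?thesis by (intro mult_right_mono) auto
  qed
  finally show ?thesis .
qed

theorem proposition11:
  fixes M :: "nat \<Rightarrow> ('a::linorder) graph"
  assumes "\<And>k. k \<ge> 1 \<Longrightarrow> ordered_matching k (M k)"
  shows "\<exists>\<epsilon> :: nat \<Rightarrow> real. \<epsilon> \<longlonglongrightarrow> 0 \<and>
           (\<lambda>n. measure_pmf.prob (RM n)
                  {G. real (max_copy M G) \<le> (1 + \<epsilon> n) * exp 1 * sqrt (real n / 2)})
             \<longlonglongrightarrow> 1"
proof (intro exI conjI)
  \<comment> \<open>The exponent makes \<epsilon> tend to 0 slowly enough: \<open>ln (?q n)\<close>
    is \<open>ln n\<close> minus a term of order
    \<open>sqrt n * n powr (-1/4) = n powr (1/4)\<close>, which dominates.\<close>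
  let ?\<epsilon> = "\<lambda>n. real n powr (-1/4)"
  let ?S = "\<lambda>n. {G. real (max_copy M G) \<le> (1 + ?\<epsilon> n) * exp 1 * sqrt (real n / 2)}"
  let ?q = "\<lambda>n. real n * (1 + ?\<epsilon> n) powr (- 2 * exp 1 * sqrt (real n / 2))"
  show "?\<epsilon> \<longlonglongrightarrow> 0" by real_asymp
  \<comment> \<open>At \<open>n = 0\<close> the maximum is over an empty set and
    \<open>0 powr (-1/4) = 0\<close> is not positive; the limit ignores this value.\<close>
  have lower: "1 - ?q n \<le> measure_pmf.prob (RM n) (?S n)" if "n \<ge> 1" for n
  proof -
    have compl: "- ?S n = {G. real (max_copy M G) > (1 + ?\<epsilon> n) * exp 1 * sqrt (real n / 2)}"
      by auto
    have "measure_pmf.prob (RM n) (- ?S n) \<le> ?q n"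
      unfolding compl using that assms by (intro prob_max_copy_gt_le) auto
    thus ?thesis
      using measure_pmf.prob_compl[of "?S n" "RM n"] by (simp add: Compl_eq_Diff_UNIV)
  qed
  show "(\<lambda>n. measure_pmf.prob (RM n) (?S n)) \<longlonglongrightarrow> 1"
  proof (rule tendsto_sandwich)
    show "\<forall>\<^sub>F n in sequentially. 1 - ?q n \<le> measure_pmf.prob (RM n) (?S n)"
      using lower by (auto intro: eventually_sequentiallyI)
    show "(\<lambda>n. 1 - ?q n) \<longlonglongrightarrow> 1" by real_asymp
  qed auto
qed

end
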